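(* The group of all regular automorphisms of the infinite Johnson graph $J_{\infty}$ coincides with the group formed by all order preserving and all order reversing bijective transformations of the vertex set of $J_{\infty}$.
   Context: The infinite Johnson graph $J_{\infty}$ is the simple graph whose vertices are all subsets $X\subset\mathbb{N}$ with $|X|=|\mathbb{N}\setminus X|=\infty$; two vertices $X,Y$ are adjacent if $|X\setminus Y|=|Y\setminus X|=1$. Every permutation $s$ of $\mathbb{N}$ induces an automorphism $X\mapsto s(X)=\{s(x):x\in X\}$ of $J_{\infty}$, and $*:X\mapsto\mathbb{N}\setminus X$ is also an automorphism of $J_{\infty}$. An automorphism of $J_{\infty}$ is called regular if it is induced by a permutation of $\mathbb{N}$ or it is the composition of $*$ and the automorphism induced by a permutation of $\mathbb{N}$. A bijective transformation $f$ of the vertex set (a bijection of the vertex set onto itself) is called order preserving if $X\subset Y\Leftrightarrow f(X)\subset f(Y)$ for all vertices $X,Y$, and order reversing if $X\subset Y\Leftrightarrow f(Y)\subset f(X)$ for all vertices $X,Y$; here $\subset$ is (non-strict) inclusion. The group operation is composition of transformations of the vertex set. *)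

theory Defs
  imports "HOL-Algebra.Bij"
begin

definition johnson_verts :: "nat set set" where
  "johnson_verts = {X. infinite X \<and> infinite (UNIV - X)}"

definition johnson_adj :: "nat set \<Rightarrow> nat set \<Rightarrow> bool" where
  "johnson_adj X Y \<longleftrightarrow>
     X \<in> johnson_verts \<and> Y \<in> johnson_verts \<and> card (X - Y) = 1 \<and> card (Y - X) = 1"

text \<open>
  Transformations of the vertex set are elements of \<^term>\<open>Bij johnson_verts\<close>: bijections of
  \<^term>\<open>johnson_verts\<close> onto itself that are \<^const>\<open>undefined\<close> elsewhere. Hence equality of
  such functions is equality of transformations of the vertex set, and \<^const>\<open>BijGroup\<close>
  provides the group operation, composition.
\<close>

definition johnson_automorphisms :: "(nat set \<Rightarrow> nat set) set" where
  "johnson_automorphisms = {f \<in> Bij johnson_verts.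
     \<forall>X \<in> johnson_verts. \<forall>Y \<in> johnson_verts. johnson_adj X Y \<longleftrightarrow> johnson_adj (f X) (f Y)}"

definition induced_map :: "(nat \<Rightarrow> nat) \<Rightarrow> nat set \<Rightarrow> nat set" where
  "induced_map s = (\<lambda>X \<in> johnson_verts. s ` X)"

definition complement_map :: "nat set \<Rightarrow> nat set" where
  "complement_map = (\<lambda>X \<in> johnson_verts. UNIV - X)"

definition regular_automorphisms :: "(nat set \<Rightarrow> nat set) set" where
  "regular_automorphisms = {f \<in> johnson_automorphisms.
     \<exists>s. bij s \<and>
       (f = induced_map s \<or> f = compose johnson_verts complement_map (induced_map s))}"

definition order_preserving :: "(nat set \<Rightarrow> nat set) set" where
  "order_preserving = {f \<in> Bij johnson_verts.
     \<forall>X \<in> johnson_verts. \<forall>Y \<in> johnson_verts. X \<subseteq> Y \<longleftrightarrow> f X \<subseteq> f Y}"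

definition order_reversing :: "(nat set \<Rightarrow> nat set) set" where
  "order_reversing = {f \<in> Bij johnson_verts.
     \<forall>X \<in> johnson_verts. \<forall>Y \<in> johnson_verts. X \<subseteq> Y \<longleftrightarrow> f Y \<subseteq> f X}"

end

theory Submission
  imports Defs "HOL-Library.Infinite_Set"
begin

text \<open>
  The point is that an automorphism \<open>f\<close> of the inclusion order on the vertices can
  be recovered from its effect on points, although points are not themselves vertices. Adding a
  point to a vertex gives a vertex, so \<open>Y\<close> covers \<open>X\<close> in this order
  exactly if \<open>Y\<close> arises from \<open>X\<close> by adding one point, and
  \<open>f\<close> preserves covers. Hence adding \<open>x\<close> to a vertex \<open>X\<close>
  adds a single point to \<open>f X\<close>. That point depends on \<open>x\<close> alone: it is
  the same for comparable vertices, and any two vertices avoiding \<open>x\<close> are joined by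
  a chain of vertices avoiding \<open>x\<close> whose consecutive members are comparable.
  Calling it \<open>s x\<close>, one gets \<open>s x \<in> f X \<longleftrightarrow> x \<in>
  X\<close> (\<open>order_preserving_tracks_points\<close>). The inverse of \<open>f\<close> has
  such a point map too, and because vertices separate points the two maps are mutually inverse,
  so \<open>s\<close> is a permutation inducing \<open>f\<close>
  (\<open>order_preserving_induced\<close>).

  Complementation exchanges order preserving and order reversing bijections, which settles the
  order reversing case. Conversely, permutations preserve inclusion and complementation reverses
  it, while the cardinalities in the definition of adjacency are kept by a permutation and swapped
  by complementation. The group structure is
  immediate on the order-theoretic side and is transported along the equality of the two sets.
\<close>

section \<open>Vertices\<close>

lemma johnson_verts_insert:
  assumes "X \<in> johnson_verts" shows "insert x X \<in> johnson_verts"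
proof -
  have "UNIV - insert x X = (UNIV - X) - {x}" by auto
  then show ?thesis using assms by (simp add: johnson_verts_def)
qed

lemma johnson_verts_remove:
  assumes "X \<in> johnson_verts" shows "X - {x} \<in> johnson_verts"
proof -
  have "UNIV - X \<subseteq> UNIV - (X - {x})" by auto
  then show ?thesis using assms by (auto simp: johnson_verts_def dest: finite_subset)
qed

lemma johnson_verts_Compl: "X \<in> johnson_verts \<Longrightarrow> UNIV - X \<in> johnson_verts"
  by (simp add: johnson_verts_def double_diff)

lemma johnson_verts_Int:
  assumes "X \<in> johnson_verts" "infinite (X \<inter> Y)"
  shows "X \<inter> Y \<in> johnson_verts"
proof -
  have "UNIV - X \<subseteq> UNIV - (X \<inter> Y)" by auto
  then show ?thesis using assms by (auto simp: johnson_verts_def dest: finite_subset)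
qed

lemma johnson_verts_image:
  assumes "bij s" "X \<in> johnson_verts"
  shows "s ` X \<in> johnson_verts"
proof -
  have "UNIV - s ` X = s ` (UNIV - X)"
    using assms(1) by (simp add: bij_def image_set_diff)
  moreover have "inj_on s A" for A
    using assms(1) by (meson bij_def inj_on_subset subset_UNIV)
  ultimately show ?thesis
    using assms(2) by (simp add: johnson_verts_def finite_image_iff)
qed

lemma johnson_verts_avoiding:
  obtains X where "X \<in> johnson_verts" "x \<notin> X"
proof -
  obtain A B :: "nat set" where AB: "infinite A" "infinite B" "A \<inter> B = {}"
    using infinite_split[OF infinite_UNIV_nat] by metis
  then have "B \<subseteq> UNIV - A" by blast
  with AB have "A \<in> johnson_verts" by (auto simp: johnson_verts_def dest: finite_subset)
  then have "A - {x} \<in> johnson_verts" by (rule johnson_verts_remove)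
  with that show thesis by blast
qed

lemma johnson_verts_separate_points:
  assumes "\<And>X. X \<in> johnson_verts \<Longrightarrow> x \<in> X \<longleftrightarrow> y \<in> X"
  shows "x = y"
proof (rule ccontr)
  assume "x \<noteq> y"
  obtain X where X: "X \<in> johnson_verts" "x \<notin> X" by (rule johnson_verts_avoiding)
  then have "insert y X \<in> johnson_verts" by (simp add: johnson_verts_insert)
  with assms X \<open>x \<noteq> y\<close> show False by blast
qed

text \<open>
  Two vertices with infinite intersection are comparable to that intersection. Otherwise one of them
  is joined with one of two disjoint infinite parts of the other: the result meets both in an infinite set,
  and it is still co-infinite because the second part is almost disjoint from it.
\<close>

lemma constant_on_johnson_verts_avoiding:
  assumes mono: "\<And>X Y. \<lbrakk>X \<in> johnson_verts; Y \<in> johnson_verts; X \<subseteq> Y; x \<notin> Y\<rbrakk> \<Longrightarrow> g X = g Y"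
    and X: "X \<in> johnson_verts" "x \<notin> X" and Y: "Y \<in> johnson_verts" "x \<notin> Y"
  shows "g X = g Y"
proof -
  have meet: "g A = g B"
    if "A \<in> johnson_verts" "B \<in> johnson_verts" "x \<notin> A" "x \<notin> B" "infinite (A \<inter> B)" for A B
  proof -
    have "A \<inter> B \<in> johnson_verts" using that by (simp add: johnson_verts_Int)
    then have "g (A \<inter> B) = g A" "g (A \<inter> B) = g B"
      using that by (auto intro: mono)
    then show ?thesis by simp
  qed
  show ?thesis
  proof (cases "finite (X \<inter> Y)")
    case True
    from X have "infinite X" by (simp add: johnson_verts_def)
    then obtain A B where AB: "A \<subseteq> X" "B \<subseteq> X" "infinite A" "infinite B" "A \<inter> B = {}"
      by (rule infinite_split)
    have "B - X \<inter> Y \<subseteq> UNIV - (A \<union> Y)" using AB by auto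
    moreover have "infinite (B - X \<inter> Y)" using True AB by (simp add: Diff_infinite_finite)
    ultimately have "infinite (UNIV - (A \<union> Y))" by (meson finite_subset)
    then have Z: "A \<union> Y \<in> johnson_verts" using AB by (simp add: johnson_verts_def)
    have "X \<inter> (A \<union> Y) \<supseteq> A" using AB by auto
    then have "infinite (X \<inter> (A \<union> Y))" using AB by (meson finite_subset)
    then have "g X = g (A \<union> Y)" using X Y Z AB by (intro meet) auto
    also have "\<dots> = g Y" using X Y Z AB by (intro mono[symmetric]) auto
    finally show ?thesis .
  qed (use meet X Y in blast)
qed

section \<open>Order preserving bijections come from permutations\<close>

lemma BijD:
  assumes "f \<in> Bij S"
  shows "f \<in> extensional S" "inj_on f S" "f ` S = S"
  using assms by (auto simp: Bij_def bij_betw_def)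

lemma order_preservingD:
  assumes "f \<in> order_preserving" "X \<in> johnson_verts" "Y \<in> johnson_verts"
  shows "f X \<subseteq> f Y \<longleftrightarrow> X \<subseteq> Y" and "f X \<in> johnson_verts"
  using assms BijD(3)[of f johnson_verts] by (auto simp: order_preserving_def)

lemma order_reversingD:
  assumes "f \<in> order_reversing" "X \<in> johnson_verts" "Y \<in> johnson_verts"
  shows "f X \<subseteq> f Y \<longleftrightarrow> Y \<subseteq> X" and "f X \<in> johnson_verts"
  using assms BijD(3)[of f johnson_verts] by (auto simp: order_reversing_def)

text \<open>
  If \<open>a\<close> is a point of \<open>f (insert x X)\<close> outside \<open>f X\<close>, then \<open>insert a (f X)\<close> is a vertex, hence the
  image of some \<open>Z\<close>. Reflecting the order puts \<open>Z\<close> between \<open>X\<close> and \<open>insert x X\<close>, which leaves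
  only \<open>Z = insert x X\<close>.
\<close>

lemma order_preserving_cover:
  assumes f: "f \<in> order_preserving" and X: "X \<in> johnson_verts" and x: "x \<notin> X"
  shows "\<exists>!a. a \<notin> f X \<and> f (insert x X) = insert a (f X)"
proof -
  let ?Y = "insert x X"
  note le = order_preservingD(1)[OF f] and V = order_preservingD(2)[OF f _ X]
  have Y: "?Y \<in> johnson_verts" using X by (rule johnson_verts_insert)
  have sub: "f X \<subseteq> f ?Y" using le[OF X Y] by auto
  have "\<not> f ?Y \<subseteq> f X" using le[OF Y X] x by auto
  then obtain a where a: "a \<in> f ?Y" "a \<notin> f X" by auto
  have "insert a (f X) \<in> johnson_verts"
    using V[OF X] by (rule johnson_verts_insert)
  moreover have "f ` johnson_verts = johnson_verts"
    using f by (intro BijD(3)) (simp add: order_preserving_def)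
  ultimately obtain Z where Z: "Z \<in> johnson_verts" "f Z = insert a (f X)"
    by (metis imageE)
  have "X \<subseteq> Z" using le[OF X Z(1)] Z by auto
  moreover have "Z \<subseteq> ?Y" using le[OF Z(1) Y] Z a sub by auto
  moreover have "Z \<noteq> X" using Z a by auto
  ultimately have "Z = ?Y" by auto
  with Z a show ?thesis by blast
qed

text \<open>
  The point added to \<open>f X\<close> when \<open>x\<close> is added to \<open>X\<close> cannot lie in \<open>f Y\<close> for a larger vertex \<open>Y\<close>
  avoiding \<open>x\<close>, since otherwise \<open>f (insert x X) \<subseteq> f Y\<close>. It must therefore be the point added to
  \<open>f Y\<close>, and so it is the same for all vertices avoiding \<open>x\<close>.
\<close>

lemma order_preserving_tracks_points:
  assumes f: "f \<in> order_preserving"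
  obtains s where "\<And>x X. X \<in> johnson_verts \<Longrightarrow> s x \<in> f X \<longleftrightarrow> x \<in> X"
proof -
  define new where "new x X = (THE a. a \<notin> f X \<and> f (insert x X) = insert a (f X))" for x X
  have new: "new x X \<notin> f X" "f (insert x X) = insert (new x X) (f X)"
    if "X \<in> johnson_verts" "x \<notin> X" for x X
    using theI'[OF order_preserving_cover[OF f that]] by (simp_all add: new_def)
  note le = order_preservingD(1)[OF f]
  have new_mono: "new x X = new x Y"
    if XY: "X \<in> johnson_verts" "Y \<in> johnson_verts" "X \<subseteq> Y" "x \<notin> Y" for x X Y
  proof -
    have x: "x \<notin> X" using XY by auto
    note ins = johnson_verts_insert[OF XY(1), of x] johnson_verts_insert[OF XY(2), of x]
    have "f (insert x X) \<subseteq> f (insert x Y)" using le[OF ins] XY by auto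
    then have "new x X \<in> insert (new x Y) (f Y)" using new XY x by auto
    moreover have "new x X \<notin> f Y"
    proof
      assume "new x X \<in> f Y"
      moreover have "f X \<subseteq> f Y" using le[OF XY(1,2)] XY(3) by simp
      ultimately have "f (insert x X) \<subseteq> f Y" using new XY x by auto
      with le[OF ins(1) XY(2)] XY show False by auto
    qed
    ultimately show ?thesis by simp
  qed
  have new_eq: "new x X = new x Y"
    if "X \<in> johnson_verts" "Y \<in> johnson_verts" "x \<notin> X" "x \<notin> Y" for x X Y
    by (rule constant_on_johnson_verts_avoiding[where g = "new x", OF new_mono that(1,3,2,4)])
  define s where "s x = new x (SOME X. X \<in> johnson_verts \<and> x \<notin> X)" for x
  have s: "s x = new x X" if "X \<in> johnson_verts" "x \<notin> X" for x X
  proof -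
    have "\<exists>X. X \<in> johnson_verts \<and> x \<notin> X" using that by blast
    from someI_ex[OF this] show ?thesis unfolding s_def using that new_eq by blast
  qed
  show thesis
  proof
    fix x X assume X: "X \<in> johnson_verts"
    show "s x \<in> f X \<longleftrightarrow> x \<in> X"
    proof (cases "x \<in> X")
      case True
      have "X - {x} \<in> johnson_verts" using X by (rule johnson_verts_remove)
      then have "f (insert x (X - {x})) = insert (s x) (f (X - {x}))"
        using new(2)[of "X - {x}" x] s[of "X - {x}" x] by simp
      then show ?thesis using True by (auto simp: insert_absorb)
    next
      case False
      then show ?thesis using new(1) s X by simp
    qed
  qed
qed

lemma order_preserving_inverse:
  assumes f: "f \<in> order_preserving"
  shows "restrict (inv_into johnson_verts f) johnson_verts \<in> order_preserving"
proof -
  let ?g = "inv_into johnson_verts f"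
  have B: "f \<in> Bij johnson_verts" using f by (simp add: order_preserving_def)
  have "?g X \<in> johnson_verts" "f (?g X) = X" if "X \<in> johnson_verts" for X
    using that BijD(3)[OF B] by (simp_all add: inv_into_into f_inv_into_f)
  then have "X \<subseteq> Y \<longleftrightarrow> ?g X \<subseteq> ?g Y" if "X \<in> johnson_verts" "Y \<in> johnson_verts" for X Y
    using that order_preservingD(1)[OF f, of "?g X" "?g Y"] by simp
  moreover have "restrict ?g johnson_verts \<in> Bij johnson_verts"
    using B by (rule restrict_inv_into_Bij)
  ultimately show ?thesis unfolding order_preserving_def by simp
qed

lemma order_reversing_inverse:
  assumes f: "f \<in> order_reversing"
  shows "restrict (inv_into johnson_verts f) johnson_verts \<in> order_reversing"
proof -
  let ?g = "inv_into johnson_verts f"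
  have B: "f \<in> Bij johnson_verts" using f by (simp add: order_reversing_def)
  have "?g X \<in> johnson_verts" "f (?g X) = X" if "X \<in> johnson_verts" for X
    using that BijD(3)[OF B] by (simp_all add: inv_into_into f_inv_into_f)
  then have "X \<subseteq> Y \<longleftrightarrow> ?g Y \<subseteq> ?g X" if "X \<in> johnson_verts" "Y \<in> johnson_verts" for X Y
    using that order_reversingD(1)[OF f, of "?g X" "?g Y"] by simp
  moreover have "restrict ?g johnson_verts \<in> Bij johnson_verts"
    using B by (rule restrict_inv_into_Bij)
  ultimately show ?thesis unfolding order_reversing_def by simp
qed

lemma order_preserving_induced:
  assumes f: "f \<in> order_preserving"
  obtains s where "bij s" "f = induced_map s"
proof -
  let ?g = "restrict (inv_into johnson_verts f) johnson_verts"
  have B: "f \<in> Bij johnson_verts" using f by (simp add: order_preserving_def)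
  have gf: "?g (f X) = X" and fg: "f (?g X) = X"
    and V: "f X \<in> johnson_verts" "?g X \<in> johnson_verts" if "X \<in> johnson_verts" for X
    using that BijD[OF B] order_preservingD(2)[OF f that that]
      order_preservingD(2)[OF order_preserving_inverse[OF f] that that]
    by (auto simp: f_inv_into_f)
  obtain s where s: "\<And>x X. X \<in> johnson_verts \<Longrightarrow> s x \<in> f X \<longleftrightarrow> x \<in> X"
    using order_preserving_tracks_points[OF f] by blast
  obtain t where t: "\<And>x X. X \<in> johnson_verts \<Longrightarrow> t x \<in> ?g X \<longleftrightarrow> x \<in> X"
    using order_preserving_tracks_points[OF order_preserving_inverse[OF f]] by blast
  \<comment> \<open>A vertex \<open>X\<close> contains \<open>t (s x)\<close> iff \<open>f X\<close> contains \<open>s x\<close>, hence iff \<open>X\<close> contains \<open>x\<close>.\<close>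
  have ts: "t (s x) = x" for x
    by (rule johnson_verts_separate_points) (metis s t gf V(1))
  have st: "s (t y) = y" for y
    by (rule johnson_verts_separate_points) (metis s t fg V(2))
  have "bij s" using ts st by (metis bijI')
  moreover have "f = induced_map s"
  proof (rule extensionalityI[where A = johnson_verts])
    show "f \<in> extensional johnson_verts" using B by (rule BijD)
    show "induced_map s \<in> extensional johnson_verts" by (simp add: induced_map_def)
    fix X assume X: "X \<in> johnson_verts"
    have "f X = s ` X" using s[OF X] st by (auto simp: image_iff) metis+
    then show "f X = induced_map s X" using X by (simp add: induced_map_def)
  qed
  ultimately show thesis by (rule that)
qed

section \<open>Complementation\<close>

lemma complement_map_Bij: "complement_map \<in> Bij johnson_verts"
proof -
  have V: "complement_map X \<in> johnson_verts" and inv: "complement_map (complement_map X) = X"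
    if "X \<in> johnson_verts" for X
    using that by (simp_all add: complement_map_def johnson_verts_Compl double_diff)
  then have "bij_betw complement_map johnson_verts johnson_verts"
    by (intro bij_betw_byWitness[where f' = complement_map]) blast+
  then show ?thesis by (simp add: Bij_def complement_map_def)
qed

lemma order_reversing_complement:
  assumes f: "f \<in> order_reversing"
  shows "compose johnson_verts complement_map f \<in> order_preserving"
proof -
  have B: "f \<in> Bij johnson_verts" using f by (simp add: order_reversing_def)
  then have V: "f X \<in> johnson_verts" if "X \<in> johnson_verts" for X
    using that BijD(3) by blast
  have "compose johnson_verts complement_map f \<in> Bij johnson_verts"
    using complement_map_Bij B by (rule compose_Bij)
  moreover have "f Y \<subseteq> f X \<longleftrightarrow> UNIV - f X \<subseteq> UNIV - f Y" for X Y by blast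
  ultimately show ?thesis
    using f V by (simp add: order_preserving_def order_reversing_def compose_def complement_map_def)
qed

lemma order_reversing_induced:
  assumes f: "f \<in> order_reversing"
  obtains s where "bij s" "f = compose johnson_verts complement_map (induced_map s)"
proof -
  have B: "f \<in> Bij johnson_verts" using f by (simp add: order_reversing_def)
  obtain s where s: "bij s" "compose johnson_verts complement_map f = induced_map s"
    using order_preserving_induced[OF order_reversing_complement[OF f]] by blast
  have "f = compose johnson_verts complement_map (induced_map s)"
  proof (rule extensionalityI[where A = johnson_verts])
    show "f \<in> extensional johnson_verts" using B by (rule BijD)
    fix X assume X: "X \<in> johnson_verts"
    then have "f X \<in> johnson_verts" using BijD(3)[OF B] by blast
    then show "f X = compose johnson_verts complement_map (induced_map s) X"
      using X by (simp add: s(2)[symmetric] compose_def complement_map_def johnson_verts_Compl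
          double_diff)
  qed simp
  with s(1) show thesis by (rule that)
qed

section \<open>The two descriptions agree\<close>

lemma johnson_adj_iff_induced:
  assumes "bij s" "X \<in> johnson_verts" "Y \<in> johnson_verts"
  shows "johnson_adj (s ` X) (s ` Y) \<longleftrightarrow> johnson_adj X Y"
proof -
  have "s ` A - s ` B = s ` (A - B)" for A B
    using assms(1) by (simp add: bij_def image_set_diff)
  moreover have "card (s ` A) = card A" for A
    using assms(1) by (meson bij_def card_image inj_on_subset subset_UNIV)
  ultimately show ?thesis
    using assms by (simp add: johnson_adj_def johnson_verts_image)
qed

lemma johnson_adj_Compl_iff:
  assumes "X \<in> johnson_verts" "Y \<in> johnson_verts"
  shows "johnson_adj (UNIV - X) (UNIV - Y) \<longleftrightarrow> johnson_adj X Y"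
proof -
  have "(UNIV - A) - (UNIV - B) = B - A" for A B :: "nat set" by auto
  then show ?thesis using assms by (auto simp: johnson_adj_def johnson_verts_Compl)
qed

lemma induced_map_adj:
  assumes "bij s" "X \<in> johnson_verts" "Y \<in> johnson_verts"
  shows "johnson_adj X Y \<longleftrightarrow> johnson_adj (induced_map s X) (induced_map s Y)"
    and "johnson_adj X Y \<longleftrightarrow>
      johnson_adj (compose johnson_verts complement_map (induced_map s) X)
        (compose johnson_verts complement_map (induced_map s) Y)"
  using assms
  by (simp_all add: induced_map_def complement_map_def compose_def johnson_verts_image
      johnson_adj_iff_induced johnson_adj_Compl_iff)

lemma induced_map_order:
  assumes "bij s" "X \<in> johnson_verts" "Y \<in> johnson_verts"
  shows "X \<subseteq> Y \<longleftrightarrow> induced_map s X \<subseteq> induced_map s Y"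
    and "X \<subseteq> Y \<longleftrightarrow> compose johnson_verts complement_map (induced_map s) Y
      \<subseteq> compose johnson_verts complement_map (induced_map s) X"
proof -
  have "s ` X \<subseteq> s ` Y \<longleftrightarrow> X \<subseteq> Y"
    using assms(1) by (simp add: bij_def inj_image_subset_iff)
  moreover have "UNIV - s ` Y \<subseteq> UNIV - s ` X \<longleftrightarrow> s ` X \<subseteq> s ` Y" by blast
  ultimately show "X \<subseteq> Y \<longleftrightarrow> induced_map s X \<subseteq> induced_map s Y"
    and "X \<subseteq> Y \<longleftrightarrow> compose johnson_verts complement_map (induced_map s) Y
      \<subseteq> compose johnson_verts complement_map (induced_map s) X"
    using assms
    by (simp_all add: induced_map_def complement_map_def compose_def johnson_verts_image)
qed

lemma regular_automorphisms_eq: "regular_automorphisms = order_preserving \<union> order_reversing"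
proof (intro equalityI subsetI)
  fix f assume "f \<in> regular_automorphisms"
  then obtain s where B: "f \<in> Bij johnson_verts" and s: "bij s"
    and "f = induced_map s \<or> f = compose johnson_verts complement_map (induced_map s)"
    by (auto simp: regular_automorphisms_def johnson_automorphisms_def)
  then show "f \<in> order_preserving \<union> order_reversing"
    using induced_map_order[OF s] by (auto simp: order_preserving_def order_reversing_def)
next
  fix f assume f: "f \<in> order_preserving \<union> order_reversing"
  then have B: "f \<in> Bij johnson_verts"
    by (auto simp: order_preserving_def order_reversing_def)
  obtain s where s: "bij s"
    and eq: "f = induced_map s \<or> f = compose johnson_verts complement_map (induced_map s)"
    using f order_preserving_induced order_reversing_induced by (metis UnE)
  have "f \<in> johnson_automorphisms"
    unfolding johnson_automorphisms_def using B eq induced_map_adj[OF s] by blast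
  with s eq show "f \<in> regular_automorphisms"
    by (auto simp: regular_automorphisms_def)
qed

lemma order_maps_subgroup:
  "subgroup (order_preserving \<union> order_reversing) (BijGroup johnson_verts)"
proof
  let ?H = "order_preserving \<union> order_reversing"
  have H: "f \<in> Bij johnson_verts" "f ` johnson_verts = johnson_verts" if "f \<in> ?H" for f
    using that BijD(3) by (auto simp: order_preserving_def order_reversing_def)
  then show "?H \<subseteq> carrier (BijGroup johnson_verts)" by (auto simp: BijGroup_def)
  show "\<one>\<^bsub>BijGroup johnson_verts\<^esub> \<in> ?H"
    by (auto simp: BijGroup_def order_preserving_def id_Bij)
  show "f \<otimes>\<^bsub>BijGroup johnson_verts\<^esub> g \<in> ?H" if f: "f \<in> ?H" and g: "g \<in> ?H" for f g
  proof -
    let ?h = "compose johnson_verts f g"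
    have h: "?h X = f (g X)" "g X \<in> johnson_verts" if "X \<in> johnson_verts" for X
      using H(2)[OF g] that by (auto simp: compose_def)
    have "?h \<in> Bij johnson_verts" using H(1)[OF f] H(1)[OF g] by (rule compose_Bij)
    moreover have "(\<forall>X\<in>johnson_verts. \<forall>Y\<in>johnson_verts. X \<subseteq> Y \<longleftrightarrow> ?h X \<subseteq> ?h Y) \<or>
        (\<forall>X\<in>johnson_verts. \<forall>Y\<in>johnson_verts. X \<subseteq> Y \<longleftrightarrow> ?h Y \<subseteq> ?h X)"
      using f g by (elim UnE) (simp_all add: h order_preservingD(1) order_reversingD(1))
    ultimately have "?h \<in> ?H" unfolding order_preserving_def order_reversing_def by blast
    then show ?thesis using H(1) f g by (simp add: BijGroup_def)
  qed
  show "inv\<^bsub>BijGroup johnson_verts\<^esub> f \<in> ?H" if f: "f \<in> ?H" for f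
    using f order_preserving_inverse order_reversing_inverse inv_BijGroup[OF H(1)[OF f]]
    by (elim UnE) simp_all
qed

theorem corollary1:
  "subgroup regular_automorphisms (BijGroup johnson_verts) \<and>
   subgroup (order_preserving \<union> order_reversing) (BijGroup johnson_verts) \<and>
   regular_automorphisms = order_preserving \<union> order_reversing"
  using order_maps_subgroup by (simp add: regular_automorphisms_eq)

end
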